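(* Let $d>1$ be an integer. Then, for any integer $p$ with $1\le p\le d-1$, $$\frac{\mathbb{E}_{\mathtt{ds}}[p,d]}{2p}>\frac{\mathbb{E}_{\mathtt{ds}}[p+1,d]}{2(p+1)}.$$
   Context: Let $1\le p\le d$ be integers. $\mathcal{S}^{d-1}$ is the Euclidean unit sphere in $\mathbb{R}^d$, and $\mathcal{V}_{p,d}=\{X\in\mathbb{R}^{d\times p}: X^{\mathrm T}X=I_p\}$ is the Stiefel manifold with its uniform distribution (the unique probability measure invariant under left multiplication by orthogonal $d\times d$ matrices). Let $g$ be uniformly distributed on $\mathcal{S}^{d-1}$ and let $B=[b_1\ \cdots\ b_p]$ be uniformly distributed on $\mathcal{V}_{p,d}$, with $g$ and $B$ independent. Put $f^{lin}(x)=g^{\mathrm T}x$. One direct-search iteration in the random subspace, from a current iterate $x^k\in\mathbb{R}^d$ and with step size $\delta=1$, does the following: with $f|_p(z)=f^{lin}(x^k+\sum_{i=1}^p z_ib_i)$ for $z\in\mathbb{R}^p$, and with $e_1,\dots,e_p$ the canonical basis of $\mathbb{R}^p$, let $z^*$ be a minimizer of $f|_p(u)$ over $u\in\{\pm e_i\}_{i=1}^p\cup\{0\}$, and set $x^{k+1}=x^k+\sum_{i=1}^p z_i^*b_i$. The expected decrease is $\mathbb{E}_{\mathtt{ds}}[p,d]:=\mathbb{E}[f^{lin}(x^k)-f^{lin}(x^{k+1})]$, the expectation being over $g$ and $B$. (The iteration evaluates the function at $2p$ new points, so $\mathbb{E}_{\mathtt{ds}}[p,d]/(2p)$ is the expected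 decrease per function evaluation.) *)

theory Defs
  imports "HOL-Probability.Probability"
begin

text \<open>
  The ambient space is \<^typ>\<open>real ^ 'd\<close>, with d the cardinality of the index type. A real d by p
  matrix is the family of its columns \<^term>\<open>X 0\<close>, ..., \<^term>\<open>X (p - 1)\<close>; it lives in
  \<^term>\<open>{..<p} \<rightarrow>\<^sub>E (UNIV :: (real ^ 'd) set)\<close>, and R^p is likewise \<^term>\<open>{..<p} \<rightarrow>\<^sub>E (UNIV :: real set)\<close>.
\<close>

definition columns_space :: "nat \<Rightarrow> (nat \<Rightarrow> real ^ 'd) measure" where
  "columns_space p = (\<Pi>\<^sub>M i\<in>{..<p}. borel)"

text \<open>The condition on the pairwise inner products is the entrywise form of \<open>X\<^sup>T X = I\<close>.\<close>

definition stiefel :: "nat \<Rightarrow> (nat \<Rightarrow> real ^ 'd) set" where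
  "stiefel p = {X \<in> {..<p} \<rightarrow>\<^sub>E UNIV. \<forall>i<p. \<forall>j<p. X i \<bullet> X j = (if i = j then 1 else 0)}"

definition left_mult :: "nat \<Rightarrow> real ^ 'd ^ 'd \<Rightarrow> (nat \<Rightarrow> real ^ 'd) \<Rightarrow> (nat \<Rightarrow> real ^ 'd)" where
  "left_mult p Q X = (\<lambda>i\<in>{..<p}. Q *v X i)"

text \<open>
  The uniform distributions are specified by their defining property: they are the unique
  probability measures on the sphere and on the Stiefel manifold (regarded as measures on the
  surrounding Euclidean space) that are invariant under the orthogonal group.
\<close>

definition uniform_on_sphere :: "(real ^ 'd) measure \<Rightarrow> bool" where
  "uniform_on_sphere \<mu> \<longleftrightarrow>
     prob_space \<mu> \<and> sets \<mu> = sets borel \<and> (AE x in \<mu>. x \<in> sphere 0 1) \<and>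
     (\<forall>Q. orthogonal_matrix Q \<longrightarrow> distr \<mu> \<mu> (\<lambda>x. Q *v x) = \<mu>)"

definition uniform_on_stiefel :: "nat \<Rightarrow> (nat \<Rightarrow> real ^ 'd) measure \<Rightarrow> bool" where
  "uniform_on_stiefel p \<mu> \<longleftrightarrow>
     prob_space \<mu> \<and> sets \<mu> = sets (columns_space p) \<and> (AE X in \<mu>. X \<in> stiefel p) \<and>
     (\<forall>Q. orthogonal_matrix Q \<longrightarrow> distr \<mu> \<mu> (left_mult p Q) = \<mu>)"

definition f_lin :: "real ^ 'd \<Rightarrow> real ^ 'd \<Rightarrow> real" where
  "f_lin g x = g \<bullet> x"

definition displace :: "nat \<Rightarrow> (nat \<Rightarrow> real ^ 'd) \<Rightarrow> real ^ 'd \<Rightarrow> (nat \<Rightarrow> real) \<Rightarrow> real ^ 'd" where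
  "displace p b x z = x + (\<Sum>i<p. z i *\<^sub>R b i)"

definition canonical_basis :: "nat \<Rightarrow> nat \<Rightarrow> nat \<Rightarrow> real" where
  "canonical_basis p i = (\<lambda>j\<in>{..<p}. if j = i then 1 else 0)"

definition poll_set :: "nat \<Rightarrow> (nat \<Rightarrow> real) set" where
  "poll_set p =
     {canonical_basis p i | i. i < p} \<union>
     {(\<lambda>j\<in>{..<p}. - canonical_basis p i j) | i. i < p} \<union>
     {\<lambda>j\<in>{..<p}. 0}"

text \<open>
  One iteration with step size 1 from \<open>x\<close> to \<open>x'\<close>. Minimizers over the poll set need not be
  unique, so this is a relation, leaving the tie-breaking rule open.
\<close>

definition ds_step ::
    "(real ^ 'd \<Rightarrow> real) \<Rightarrow> nat \<Rightarrow> (nat \<Rightarrow> real ^ 'd) \<Rightarrow> real ^ 'd \<Rightarrow> real ^ 'd \<Rightarrow> bool" where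
  "ds_step f p b x x' \<longleftrightarrow>
     (\<exists>z. is_arg_min (\<lambda>u. f (displace p b x u)) (\<lambda>u. u \<in> poll_set p) z \<and> x' = displace p b x z)"

text \<open>
  Independence is that of the generated sigma-algebras, since \<^const>\<open>prob_space.indep_var\<close>
  requires both random variables to have the same value type. The next iterate need not be
  assumed measurable: the decrease involves it only through the minimal value over the poll
  set, which does not depend on the choice of the minimizer.
\<close>

locale random_subspace_ds = prob_space M
  for M :: "'a measure" +
  fixes p :: nat
    and g :: "'a \<Rightarrow> real ^ 'd"
    and B :: "'a \<Rightarrow> nat \<Rightarrow> real ^ 'd"
    and x :: "real ^ 'd"
    and x_next :: "'a \<Rightarrow> real ^ 'd"
  assumes g_measurable: "random_variable borel g"
    and B_measurable: "random_variable (columns_space p) B"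
    and g_uniform: "uniform_on_sphere (distr M borel g)"
    and B_uniform: "uniform_on_stiefel p (distr M (columns_space p) B)"
    and g_B_indep:
      "indep_set
         (sigma_sets (space M) {g -` A \<inter> space M | A. A \<in> sets borel})
         (sigma_sets (space M) {B -` A \<inter> space M | A. A \<in> sets (columns_space p)})"
    and step: "\<And>\<omega>. \<omega> \<in> space M \<Longrightarrow> ds_step (f_lin (g \<omega>)) p (B \<omega>) x (x_next \<omega>)"

definition expected_decrease ::
    "'a measure \<Rightarrow> ('a \<Rightarrow> real ^ 'd) \<Rightarrow> real ^ 'd \<Rightarrow> ('a \<Rightarrow> real ^ 'd) \<Rightarrow> real" where
  "expected_decrease M g x x_next = (\<integral>\<omega>. f_lin (g \<omega>) x - f_lin (g \<omega>) (x_next \<omega>) \<partial>M)"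

end

theory Submission
  imports Defs
begin

text \<open>
  The decrease of one iteration is the largest of the numbers \<open>\<bar>g \<bullet> b\<^sub>i\<bar>\<close> over \<open>i < p\<close>, because the
  poll set contains \<open>\<plusminus> e\<^sub>i\<close> and the objective is linear. Let \<open>m p\<close> be its expectation.

  As \<open>g\<close> and \<open>B\<close> are independent, the expectation can be taken first over \<open>g\<close> with the frame fixed.
  The law of \<open>g\<close> is invariant under orthogonal maps, and any orthonormal family can be moved
  to any other one with equally many vectors by such a map, so the inner expectation is the same for every orthonormal
  family of the same size (\<open>integral_frame_max_eq\<close>), and \<open>m p\<close> is its value
  (\<open>expected_decrease_eq_sphere_average\<close>).

  The two iterations compared have different gradients. That both laws on the sphere give
  the same averages is seen without constructing a Haar measure: integrating first over the
  frame of \<open>p + 1\<close> vectors instead gives a number that is independent of the gradient, by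
  invariance of the law of the frame (\<open>sphere_average_eq_stiefel_average\<close>).

  It remains to compare \<open>m p\<close> with \<open>m (p + 1)\<close> for a single law on the sphere and a single
  orthonormal family \<open>b\<^sub>0, \<dots>, b\<^sub>p\<close>. Leaving out one of these vectors preserves the maximum
  of the \<open>\<bar>g \<bullet> b\<^sub>i\<bar>\<close> unless it is the vector attaining it, and then a value at least
  \<open>min \<bar>g \<bullet> b\<^sub>0\<bar> \<bar>g \<bullet> b\<^sub>1\<bar>\<close> is left. Summing over the vector left out
  (\<open>frame_max_leave_one_out\<close>) and taking expectations,
  \<open>(p + 1) * m p \<ge> p * m (p + 1) + E (min \<bar>g \<bullet> b\<^sub>0\<bar> \<bar>g \<bullet> b\<^sub>1\<bar>)\<close>. The last term is positive, since
  two orthogonal coordinates of \<open>g\<close> cannot have zero product almost surely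
  (\<open>not_AE_product_of_coordinates_eq_0\<close>).
\<close>

section \<open>Orthonormal families and the largest coordinate\<close>

text \<open>
  The vectors \<open>b i\<close> with \<open>i\<close> in \<open>I\<close> are pairwise orthogonal unit vectors. The index set is
  arbitrary, so that vectors can be left out of a family without renumbering.
\<close>

definition orthonormal_on :: "'i set \<Rightarrow> ('i \<Rightarrow> 'v::euclidean_space) \<Rightarrow> bool" where
  "orthonormal_on I b \<longleftrightarrow> (\<forall>i\<in>I. \<forall>j\<in>I. b i \<bullet> b j = (if i = j then 1 else 0))"

text \<open>
  The largest absolute value of the coordinates of \<open>g\<close> along the vectors \<open>b i\<close> with \<open>i\<close> in \<open>I\<close>.
  It is meaningful only for finite nonempty \<open>I\<close>.
\<close>

definition frame_max :: "'i set \<Rightarrow> ('i \<Rightarrow> 'v::euclidean_space) \<Rightarrow> 'v \<Rightarrow> real" where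
  "frame_max I b g = Max ((\<lambda>i. \<bar>g \<bullet> b i\<bar>) ` I)"

lemma orthonormal_onD:
  "orthonormal_on I b \<Longrightarrow> i \<in> I \<Longrightarrow> j \<in> I \<Longrightarrow> b i \<bullet> b j = (if i = j then 1 else 0)"
  by (auto simp: orthonormal_on_def)

lemma orthonormal_on_subset: "orthonormal_on I b \<Longrightarrow> J \<subseteq> I \<Longrightarrow> orthonormal_on J b"
  unfolding orthonormal_on_def by blast

lemma orthonormal_on_reindex:
  "orthonormal_on J b \<Longrightarrow> bij_betw h I J \<Longrightarrow> orthonormal_on I (b \<circ> h)"
  by (auto simp: orthonormal_on_def bij_betw_def inj_on_def)

lemma frame_max_nonneg: "finite I \<Longrightarrow> I \<noteq> {} \<Longrightarrow> 0 \<le> frame_max I b g"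
  unfolding frame_max_def by (subst Max_ge_iff) auto

lemma frame_max_ge: "finite I \<Longrightarrow> i \<in> I \<Longrightarrow> \<bar>g \<bullet> b i\<bar> \<le> frame_max I b g"
  unfolding frame_max_def by (rule Max_ge) auto

lemma frame_max_cong:
  "(\<And>i. i \<in> I \<Longrightarrow> g \<bullet> b i = h \<bullet> c i) \<Longrightarrow> frame_max I b g = frame_max I c h"
  unfolding frame_max_def by (intro arg_cong[where f = Max] image_cong) auto

lemma frame_max_reindex: "bij_betw h I J \<Longrightarrow> frame_max J b g = frame_max I (b \<circ> h) g"
  unfolding frame_max_def bij_betw_def by (auto simp: image_image)

lemma borel_measurable_frame_max:
  "finite I \<Longrightarrow> frame_max I b \<in> borel_measurable borel"
  unfolding frame_max_def by measurable

lemma frame_max_le_norm: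
  assumes "finite I" "I \<noteq> {}" "orthonormal_on I b"
  shows "frame_max I b g \<le> norm g"
proof -
  have "\<bar>g \<bullet> b i\<bar> \<le> norm g" if "i \<in> I" for i
  proof -
    have "norm (b i) = 1"
      using orthonormal_onD[OF assms(3) that that] by (simp add: norm_eq_1)
    then show ?thesis
      using Cauchy_Schwarz_ineq2[of g "b i"] by simp
  qed
  then show ?thesis
    unfolding frame_max_def using assms(1,2) by simp
qed

section \<open>Moving orthonormal families by orthogonal maps\<close>

text \<open>
  The witness is the reflection along \<open>a - c\<close>. When \<open>a = c\<close> the quotient in its formula is a
  division by zero, hence zero, and the formula gives the identity, as required.
\<close>

lemma orthogonal_transformation_swap:
  fixes a c :: "'v::euclidean_space"
  assumes "norm a = 1" "norm c = 1"
  obtains r where "orthogonal_transformation r" "r a = c"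
    "\<And>x. x \<bullet> a = 0 \<Longrightarrow> x \<bullet> c = 0 \<Longrightarrow> r x = x"
proof
  define v where "v = a - c"
  let ?r = "\<lambda>x. x - (2 * (x \<bullet> v) / (v \<bullet> v)) *\<^sub>R v"
  have sq: "a \<bullet> a = 1" "c \<bullet> c = 1"
    using assms by (simp_all add: norm_eq_1)
  show "orthogonal_transformation ?r"
    unfolding orthogonal_transformation_def
  proof (intro conjI allI)
    show "linear ?r"
      by (rule linearI)
        (simp_all add: inner_add_left distrib_left add_divide_distrib scaleR_add_left scaleR_diff_right)
    fix x y
    show "?r x \<bullet> ?r y = x \<bullet> y"
      by (cases "v = 0") (simp_all add: inner_diff_left inner_diff_right inner_commute field_simps)
  qed
  show "?r a = c"
  proof (cases "v = 0")
    case False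
    have "2 * (a \<bullet> v) = v \<bullet> v"
      by (simp add: v_def inner_diff_left inner_diff_right sq inner_commute)
    moreover have "v \<bullet> v \<noteq> 0" using False by simp
    ultimately have "2 * (a \<bullet> v) / (v \<bullet> v) = 1" by simp
    then have "?r a = a - v" by (simp only: scaleR_one)
    then show ?thesis by (simp add: v_def)
  qed (simp add: v_def)
  show "?r x = x" if "x \<bullet> a = 0" "x \<bullet> c = 0" for x
    using that by (simp add: v_def inner_diff_right)
qed

text \<open>
  Vectors are moved one at a time: the reflection that corrects the image of the new vector
  fixes the targets already reached, since they are orthogonal to both vectors it exchanges.
\<close>

lemma orthonormal_on_transport:
  fixes a b :: "'i \<Rightarrow> 'v::euclidean_space"
  assumes "finite I" "orthonormal_on I a" "orthonormal_on I b"
  shows "\<exists>f. orthogonal_transformation f \<and> (\<forall>i\<in>I. f (a i) = b i)"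
  using assms
proof (induction I rule: finite_induct)
  case empty
  then show ?case using orthogonal_transformation_id by blast
next
  case (insert k I)
  then obtain f where f: "orthogonal_transformation f" "\<And>i. i \<in> I \<Longrightarrow> f (a i) = b i"
    using orthonormal_on_subset[of "insert k I" _ I] by blast
  have f_inner: "f x \<bullet> f y = x \<bullet> y" for x y
    using f(1) by (simp add: orthogonal_transformation_def)
  have "norm (f (a k)) = 1"
    using orthonormal_onD[OF insert.prems(1), of k k] by (simp add: norm_eq_1 f_inner)
  moreover have "norm (b k) = 1"
    using orthonormal_onD[OF insert.prems(2), of k k] by (simp add: norm_eq_1)
  ultimately obtain r where r: "orthogonal_transformation r" "r (f (a k)) = b k"
    "\<And>x. x \<bullet> f (a k) = 0 \<Longrightarrow> x \<bullet> b k = 0 \<Longrightarrow> r x = x"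
    using orthogonal_transformation_swap by metis
  have "r (f (a i)) = b i" if "i \<in> I" for i
  proof -
    have "i \<noteq> k" using that insert.hyps by auto
    then have "f (a i) \<bullet> f (a k) = 0" "b i \<bullet> b k = 0"
      using orthonormal_onD[OF insert.prems(1), of i k] orthonormal_onD[OF insert.prems(2), of i k] that
      by (simp_all add: f_inner)
    then show ?thesis using r(3)[of "b i"] f(2)[OF that] by simp
  qed
  moreover have "orthogonal_transformation (r \<circ> f)"
    using r(1) f(1) by (rule orthogonal_transformation_compose)
  ultimately show ?case
    using r(2) by (metis comp_apply insertE)
qed

section \<open>Averages over the sphere and over the Stiefel manifold\<close>

lemma orthogonal_transformation_as_matrix:
  fixes f :: "real ^ 'd \<Rightarrow> real ^ 'd"
  assumes "orthogonal_transformation f"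
  shows "orthogonal_matrix (matrix f)" "(\<lambda>x. matrix f *v x) = f"
  using assms matrix_works[of f]
  by (auto simp: orthogonal_transformation_matrix)

lemma orthogonal_transformation_measurable:
  fixes f :: "'v::euclidean_space \<Rightarrow> 'v"
  assumes "orthogonal_transformation f"
  shows "f \<in> borel_measurable borel"
  using assms orthogonal_transformation_linear
  by (intro borel_measurable_continuous_onI linear_continuous_on linear_conv_bounded_linear[THEN iffD1])

text \<open>
  Replacing the family \<open>a\<close> by the family \<open>b\<close> amounts to a measure-preserving change of the
  point on the sphere.
\<close>

lemma uniform_on_sphere_transport:
  fixes a b :: "'i \<Rightarrow> real ^ 'd"
  assumes "uniform_on_sphere \<mu>" "finite I" "orthonormal_on I a" "orthonormal_on I b"
  obtains f where "f \<in> measurable \<mu> \<mu>" "distr \<mu> \<mu> f = \<mu>"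
    "\<And>x i. i \<in> I \<Longrightarrow> f x \<bullet> b i = x \<bullet> a i"
proof -
  obtain f where f: "orthogonal_transformation f" "\<And>i. i \<in> I \<Longrightarrow> f (a i) = b i"
    using orthonormal_on_transport[OF assms(2-4)] by blast
  have sets: "sets \<mu> = sets borel"
    using assms(1) by (simp add: uniform_on_sphere_def)
  show ?thesis
  proof
    show "f \<in> measurable \<mu> \<mu>"
      using orthogonal_transformation_measurable[OF f(1)] by (simp cong: measurable_cong_sets add: sets)
    show "distr \<mu> \<mu> f = \<mu>"
      using assms(1) orthogonal_transformation_as_matrix[OF f(1)]
      unfolding uniform_on_sphere_def by metis
    show "f x \<bullet> b i = x \<bullet> a i" if "i \<in> I" for x i
      using f that unfolding orthogonal_transformation_def by metis
  qed
qed

lemma nn_integral_frame_max_eq: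
  fixes a b :: "'i \<Rightarrow> real ^ 'd"
  assumes \<mu>: "uniform_on_sphere \<mu>" and I: "finite I" "orthonormal_on I a" "orthonormal_on I b"
  shows "(\<integral>\<^sup>+g. ennreal (frame_max I b g) \<partial>\<mu>) = (\<integral>\<^sup>+g. ennreal (frame_max I a g) \<partial>\<mu>)"
proof -
  obtain f where f: "f \<in> measurable \<mu> \<mu>" "distr \<mu> \<mu> f = \<mu>"
    "\<And>x i. i \<in> I \<Longrightarrow> f x \<bullet> b i = x \<bullet> a i"
    by (rule uniform_on_sphere_transport[OF assms]) blast
  have sets: "sets \<mu> = sets borel"
    using \<mu> by (simp add: uniform_on_sphere_def)
  have meas: "(\<lambda>g. ennreal (frame_max I b g)) \<in> borel_measurable \<mu>"
    using borel_measurable_frame_max[OF I(1), of b]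
    by (auto cong: measurable_cong_sets simp: sets)
  have "(\<integral>\<^sup>+g. ennreal (frame_max I b g) \<partial>\<mu>) = (\<integral>\<^sup>+g. ennreal (frame_max I b g) \<partial>distr \<mu> \<mu> f)"
    by (simp add: f(2))
  also have "\<dots> = (\<integral>\<^sup>+g. ennreal (frame_max I b (f g)) \<partial>\<mu>)"
    using meas by (intro nn_integral_distr f(1)) (simp add: f(2))
  also have "\<dots> = (\<integral>\<^sup>+g. ennreal (frame_max I a g) \<partial>\<mu>)"
    by (simp only: frame_max_cong[OF f(3)])
  finally show ?thesis .
qed

lemma uniform_on_stiefel_frame_max_eq:
  fixes u v :: "real ^ 'd"
  assumes \<nu>: "uniform_on_stiefel k \<nu>" and uv: "norm u = 1" "norm v = 1"
  shows "(\<integral>\<^sup>+b. ennreal (frame_max {..<k} b v) \<partial>\<nu>) = (\<integral>\<^sup>+b. ennreal (frame_max {..<k} b u) \<partial>\<nu>)"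
proof -
  obtain f where f: "orthogonal_transformation f" "f u = v"
    using orthogonal_transformation_swap[OF uv] by metis
  have sets: "sets \<nu> = sets (columns_space k)"
    using \<nu> by (simp add: uniform_on_stiefel_def)
  let ?f = "left_mult k (matrix f)"
  have f_eq: "?f = (\<lambda>b. \<lambda>i\<in>{..<k}. f (b i))"
    using orthogonal_transformation_as_matrix(2)[OF f(1)] unfolding left_mult_def by metis
  have "?f \<in> measurable (columns_space k) (columns_space k)"
    unfolding f_eq columns_space_def
    by (intro measurable_restrict measurable_compose[OF measurable_component_singleton]
        orthogonal_transformation_measurable f)
  then have f_meas: "?f \<in> measurable \<nu> \<nu>"
    by (simp cong: measurable_cong_sets add: sets)
  have inv: "distr \<nu> \<nu> ?f = \<nu>"
    using \<nu> orthogonal_transformation_as_matrix(1)[OF f(1)]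
    unfolding uniform_on_stiefel_def by blast
  have "(\<lambda>b. ennreal (frame_max {..<k} b v)) \<in> borel_measurable (columns_space k)"
    unfolding frame_max_def columns_space_def
    by measurable
  then have meas: "(\<lambda>b. ennreal (frame_max {..<k} b v)) \<in> borel_measurable \<nu>"
    by (simp cong: measurable_cong_sets add: sets)
  have "(\<integral>\<^sup>+b. ennreal (frame_max {..<k} b v) \<partial>\<nu>) = (\<integral>\<^sup>+b. ennreal (frame_max {..<k} b v) \<partial>distr \<nu> \<nu> ?f)"
    by (simp add: inv)
  also have "\<dots> = (\<integral>\<^sup>+b. ennreal (frame_max {..<k} (?f b) v) \<partial>\<nu>)"
    using meas by (intro nn_integral_distr f_meas) (simp add: inv)
  also have "\<dots> = (\<integral>\<^sup>+b. ennreal (frame_max {..<k} b u) \<partial>\<nu>)"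
  proof -
    have "frame_max {..<k} (?f b) v = frame_max {..<k} b u" for b
      using f by (intro frame_max_cong) (auto simp: f_eq orthogonal_transformation_def)
    then show ?thesis by simp
  qed
  finally show ?thesis .
qed

lemma measurable_frame_max_pair:
  "(\<lambda>(g, c). ennreal (frame_max {..<k} c g)) \<in> borel_measurable (borel \<Otimes>\<^sub>M columns_space k)"
  unfolding frame_max_def columns_space_def split_beta'
  by measurable

text \<open>
  Almost every frame \<open>c\<close> is orthonormal, so the integral over the sphere with \<open>c\<close> fixed is
  almost surely the one for the given frame \<open>b\<close>.
\<close>

lemma nn_integral_frame_max_product:
  fixes b :: "nat \<Rightarrow> real ^ 'd"
  assumes \<mu>: "uniform_on_sphere \<mu>" and \<nu>: "uniform_on_stiefel k \<nu>"
    and b: "orthonormal_on {..<k} b"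
  shows "(\<integral>\<^sup>+(g, c). ennreal (frame_max {..<k} c g) \<partial>(\<mu> \<Otimes>\<^sub>M \<nu>)) = (\<integral>\<^sup>+g. ennreal (frame_max {..<k} b g) \<partial>\<mu>)"
proof -
  interpret \<mu>: prob_space \<mu> using \<mu> by (simp add: uniform_on_sphere_def)
  interpret \<nu>: prob_space \<nu> using \<nu> by (simp add: uniform_on_stiefel_def)
  interpret P: pair_sigma_finite \<mu> \<nu> ..
  have sets: "sets \<mu> = sets borel" "sets \<nu> = sets (columns_space k)"
    using \<mu> \<nu> by (simp_all add: uniform_on_sphere_def uniform_on_stiefel_def)
  have "sets (\<mu> \<Otimes>\<^sub>M \<nu>) = sets (borel \<Otimes>\<^sub>M columns_space k)"
    using sets by (rule sets_pair_measure_cong)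
  then have meas: "(\<lambda>(g, c). ennreal (frame_max {..<k} c g)) \<in> borel_measurable (\<mu> \<Otimes>\<^sub>M \<nu>)"
    using measurable_frame_max_pair by (simp cong: measurable_cong_sets)
  have "(\<integral>\<^sup>+(g, c). ennreal (frame_max {..<k} c g) \<partial>(\<mu> \<Otimes>\<^sub>M \<nu>))
      = (\<integral>\<^sup>+c. \<integral>\<^sup>+g. ennreal (frame_max {..<k} c g) \<partial>\<mu> \<partial>\<nu>)"
    using P.nn_integral_snd[OF meas] by simp
  also have "\<dots> = (\<integral>\<^sup>+c. (\<integral>\<^sup>+g. ennreal (frame_max {..<k} b g) \<partial>\<mu>) \<partial>\<nu>)"
  proof (rule nn_integral_cong_AE)
    have "AE c in \<nu>. c \<in> stiefel k"
      using \<nu> by (simp add: uniform_on_stiefel_def)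
    then show "AE c in \<nu>. (\<integral>\<^sup>+g. ennreal (frame_max {..<k} c g) \<partial>\<mu>)
        = (\<integral>\<^sup>+g. ennreal (frame_max {..<k} b g) \<partial>\<mu>)"
    proof eventually_elim
      case (elim c)
      then have "orthonormal_on {..<k} c"
        by (auto simp: stiefel_def orthonormal_on_def)
      then show ?case
        by (intro nn_integral_frame_max_eq \<mu> b) auto
    qed
  qed
  also have "\<dots> = (\<integral>\<^sup>+g. ennreal (frame_max {..<k} b g) \<partial>\<mu>)"
    by (simp add: \<nu>.emeasure_space_1)
  finally show ?thesis .
qed

text \<open>
  The right-hand side does not mention \<open>\<mu>\<close>. This replaces the uniqueness of the
  invariant probability measure on the sphere.
\<close>

lemma sphere_average_eq_stiefel_average:
  fixes b :: "nat \<Rightarrow> real ^ 'd" and u :: "real ^ 'd"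
  assumes \<mu>: "uniform_on_sphere \<mu>" and \<nu>: "uniform_on_stiefel k \<nu>"
    and b: "orthonormal_on {..<k} b" and u: "norm u = 1"
  shows "(\<integral>\<^sup>+g. ennreal (frame_max {..<k} b g) \<partial>\<mu>) = (\<integral>\<^sup>+c. ennreal (frame_max {..<k} c u) \<partial>\<nu>)"
proof -
  interpret \<mu>: prob_space \<mu> using \<mu> by (simp add: uniform_on_sphere_def)
  interpret \<nu>: prob_space \<nu> using \<nu> by (simp add: uniform_on_stiefel_def)
  have sets: "sets \<mu> = sets borel" "sets \<nu> = sets (columns_space k)"
    using \<mu> \<nu> by (simp_all add: uniform_on_sphere_def uniform_on_stiefel_def)
  have "sets (\<mu> \<Otimes>\<^sub>M \<nu>) = sets (borel \<Otimes>\<^sub>M columns_space k)"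
    using sets by (rule sets_pair_measure_cong)
  then have meas: "(\<lambda>(g, c). ennreal (frame_max {..<k} c g)) \<in> borel_measurable (\<mu> \<Otimes>\<^sub>M \<nu>)"
    using measurable_frame_max_pair by (simp cong: measurable_cong_sets)
  have "(\<integral>\<^sup>+g. ennreal (frame_max {..<k} b g) \<partial>\<mu>)
      = (\<integral>\<^sup>+(g, c). ennreal (frame_max {..<k} c g) \<partial>(\<mu> \<Otimes>\<^sub>M \<nu>))"
    by (rule nn_integral_frame_max_product[OF \<mu> \<nu> b, symmetric])
  also have "\<dots> = (\<integral>\<^sup>+g. \<integral>\<^sup>+c. ennreal (frame_max {..<k} c g) \<partial>\<nu> \<partial>\<mu>)"
    using \<nu>.nn_integral_fst[OF meas] by simp
  also have "\<dots> = (\<integral>\<^sup>+g. (\<integral>\<^sup>+c. ennreal (frame_max {..<k} c u) \<partial>\<nu>) \<partial>\<mu>)"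
  proof (rule nn_integral_cong_AE)
    have "AE g in \<mu>. g \<in> sphere 0 1"
      using \<mu> by (simp add: uniform_on_sphere_def)
    then show "AE g in \<mu>. (\<integral>\<^sup>+c. ennreal (frame_max {..<k} c g) \<partial>\<nu>)
        = (\<integral>\<^sup>+c. ennreal (frame_max {..<k} c u) \<partial>\<nu>)"
      by eventually_elim (auto intro!: uniform_on_stiefel_frame_max_eq[OF \<nu> u])
  qed
  also have "\<dots> = (\<integral>\<^sup>+c. ennreal (frame_max {..<k} c u) \<partial>\<nu>)"
    by (simp add: \<mu>.emeasure_space_1)
  finally show ?thesis .
qed

lemma integral_frame_max_eq_enn2real:
  assumes "sets \<mu> = sets borel" "finite I" "I \<noteq> {}"
  shows "(\<integral>g. frame_max I b g \<partial>\<mu>) = enn2real (\<integral>\<^sup>+g. ennreal (frame_max I b g) \<partial>\<mu>)"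
  using borel_measurable_frame_max[OF assms(2), of b] assms
  by (intro integral_eq_nn_integral) (auto simp: frame_max_nonneg cong: measurable_cong_sets)

lemma integral_frame_max_eq:
  fixes a :: "'i \<Rightarrow> real ^ 'd" and b :: "'j \<Rightarrow> real ^ 'd"
  assumes \<mu>: "uniform_on_sphere \<mu>" and "finite I" "finite J" "card I = card J" "I \<noteq> {}"
    and ab: "orthonormal_on I a" "orthonormal_on J b"
  shows "(\<integral>g. frame_max J b g \<partial>\<mu>) = (\<integral>g. frame_max I a g \<partial>\<mu>)"
proof -
  obtain h where h: "bij_betw h I J"
    using assms finite_same_card_bij by blast
  have "sets \<mu> = sets borel" using \<mu> by (simp add: uniform_on_sphere_def)
  then show ?thesis
    unfolding frame_max_reindex[OF h] using assms
    by (simp add: integral_frame_max_eq_enn2real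
        nn_integral_frame_max_eq[OF \<mu> \<open>finite I\<close> ab(1) orthonormal_on_reindex[OF ab(2) h]])
qed

section \<open>The expected decrease as an average over the sphere\<close>

lemma ds_step_decrease:
  assumes "ds_step (f_lin g) p b x x'" "1 \<le> p"
  shows "f_lin g x - f_lin g x' = frame_max {..<p} b g"
proof -
  let ?f = "\<lambda>u. f_lin g (displace p b x u)"
  obtain z where z: "z \<in> poll_set p" "\<And>u. u \<in> poll_set p \<Longrightarrow> ?f z \<le> ?f u" "x' = displace p b x z"
    using assms(1) unfolding ds_step_def is_arg_min_linorder by auto
  have pos: "?f (canonical_basis p i) = g \<bullet> x + g \<bullet> b i"
    and neg: "?f (\<lambda>j\<in>{..<p}. - canonical_basis p i j) = g \<bullet> x - g \<bullet> b i" if "i < p" for i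
  proof -
    have "(\<Sum>j<p. canonical_basis p i j *\<^sub>R b j) = (\<Sum>j<p. if j = i then b j else 0)"
      by (intro sum.cong) (auto simp: canonical_basis_def)
    also have "\<dots> = b i" using that by simp
    finally have s: "(\<Sum>j<p. canonical_basis p i j *\<^sub>R b j) = b i" .
    then show "?f (canonical_basis p i) = g \<bullet> x + g \<bullet> b i"
      by (simp add: f_lin_def displace_def inner_add_right)
    have "(\<Sum>j<p. (\<lambda>j\<in>{..<p}. - canonical_basis p i j) j *\<^sub>R b j) = - b i"
      using s by (simp add: sum_negf)
    then show "?f (\<lambda>j\<in>{..<p}. - canonical_basis p i j) = g \<bullet> x - g \<bullet> b i"
      unfolding f_lin_def displace_def by (simp only: inner_add_right inner_minus_right)
  qed
  have zero: "?f (\<lambda>j\<in>{..<p}. 0) = g \<bullet> x"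
    by (simp add: f_lin_def displace_def)
  show ?thesis
  proof (rule antisym)
    have "g \<bullet> x - ?f z \<le> frame_max {..<p} b g"
    proof -
      consider i where "i < p" "z = canonical_basis p i"
        | i where "i < p" "z = (\<lambda>j\<in>{..<p}. - canonical_basis p i j)"
        | "z = (\<lambda>j\<in>{..<p}. 0)"
        using z(1) unfolding poll_set_def by blast
      then show ?thesis
      proof cases
        case 1
        then show ?thesis using frame_max_ge[of "{..<p}" i g b] pos by auto
      next
        case 2
        then show ?thesis using frame_max_ge[of "{..<p}" i g b] neg by auto
      next
        case 3
        then show ?thesis using frame_max_nonneg[of "{..<p}" b g] zero assms(2) by (auto simp: lessThan_empty_iff)
      qed
    qed
    then show "f_lin g x - f_lin g x' \<le> frame_max {..<p} b g"
      by (simp add: z(3) f_lin_def)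
    have "\<bar>g \<bullet> b i\<bar> \<le> g \<bullet> x - ?f z" if "i < p" for i
    proof -
      have "canonical_basis p i \<in> poll_set p" "(\<lambda>j\<in>{..<p}. - canonical_basis p i j) \<in> poll_set p"
        using that unfolding poll_set_def by blast+
      then show ?thesis
        using z(2)[of "canonical_basis p i"] z(2)[of "\<lambda>j\<in>{..<p}. - canonical_basis p i j"]
          pos[OF that] neg[OF that] by linarith
    qed
    then show "frame_max {..<p} b g \<le> f_lin g x - f_lin g x'"
      using assms(2) unfolding frame_max_def z(3) by (subst Max_le_iff) (auto simp: f_lin_def lessThan_empty_iff)
  qed
qed

text \<open>
  Independence of two random variables that may have different value types, phrased through
  the generated sigma-algebras, makes the joint law a product.
\<close>

lemma (in prob_space) distr_Pair_eq_pair_measure: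
  assumes X: "random_variable S X" and Y: "random_variable T Y"
    and indep: "indep_set (sigma_sets (space M) {X -` A \<inter> space M | A. A \<in> sets S})
      (sigma_sets (space M) {Y -` A \<inter> space M | A. A \<in> sets T})"
  shows "distr M (S \<Otimes>\<^sub>M T) (\<lambda>\<omega>. (X \<omega>, Y \<omega>)) = distr M S X \<Otimes>\<^sub>M distr M T Y"
proof (rule pair_measure_eqI[symmetric])
  interpret X: prob_space "distr M S X" using X by (rule prob_space_distr)
  interpret Y: prob_space "distr M T Y" using Y by (rule prob_space_distr)
  show "sigma_finite_measure (distr M S X)" "sigma_finite_measure (distr M T Y)" ..
  show "sets (distr M S X \<Otimes>\<^sub>M distr M T Y) = sets (distr M (S \<Otimes>\<^sub>M T) (\<lambda>\<omega>. (X \<omega>, Y \<omega>)))"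
    by (simp cong: sets_pair_measure_cong)
  fix A C assume "A \<in> sets (distr M S X)" "C \<in> sets (distr M T Y)"
  then have AC: "A \<in> sets S" "C \<in> sets T" by simp_all
  have pre: "(\<lambda>\<omega>. (X \<omega>, Y \<omega>)) -` (A \<times> C) \<inter> space M = (X -` A \<inter> space M) \<inter> (Y -` C \<inter> space M)"
    by auto
  have "prob ((X -` A \<inter> space M) \<inter> (Y -` C \<inter> space M)) = prob (X -` A \<inter> space M) * prob (Y -` C \<inter> space M)"
    using AC by (intro indep_setD[OF indep] sigma_sets.Basic) blast+
  then show "emeasure (distr M S X) A * emeasure (distr M T Y) C
      = emeasure (distr M (S \<Otimes>\<^sub>M T) (\<lambda>\<omega>. (X \<omega>, Y \<omega>))) (A \<times> C)"
    using AC X Y by (simp add: emeasure_distr pre emeasure_eq_measure ennreal_mult)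
qed

lemma expected_decrease_eq_sphere_average:
  fixes b :: "nat \<Rightarrow> real ^ 'd"
  assumes ds: "random_subspace_ds M p g B x x_next" and "1 \<le> p"
    and b: "orthonormal_on {..<p} b"
  shows "expected_decrease M g x x_next = (\<integral>v. frame_max {..<p} b v \<partial>distr M borel g)"
proof -
  interpret random_subspace_ds M p g B x x_next by (rule ds)
  let ?F = "\<lambda>(g, b). ennreal (frame_max {..<p} b g)"
  have pair: "(\<lambda>\<omega>. (g \<omega>, B \<omega>)) \<in> measurable M (borel \<Otimes>\<^sub>M columns_space p)"
    using g_measurable B_measurable by (rule measurable_Pair)
  have nonempty: "{..<p} \<noteq> {}" using \<open>1 \<le> p\<close> by (auto simp: lessThan_empty_iff)
  have "(\<lambda>(g, b :: nat \<Rightarrow> real ^ 'd). frame_max {..<p} b g)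
      \<in> borel_measurable (borel \<Otimes>\<^sub>M columns_space p)"
    unfolding frame_max_def columns_space_def split_beta' by measurable
  from measurable_compose[OF pair this]
  have meas: "(\<lambda>\<omega>. frame_max {..<p} (B \<omega>) (g \<omega>)) \<in> borel_measurable M" by simp
  have "expected_decrease M g x x_next = (\<integral>\<omega>. frame_max {..<p} (B \<omega>) (g \<omega>) \<partial>M)"
    unfolding expected_decrease_def
    by (intro Bochner_Integration.integral_cong refl ds_step_decrease step \<open>1 \<le> p\<close>)
  also have "\<dots> = enn2real (\<integral>\<^sup>+\<omega>. ennreal (frame_max {..<p} (B \<omega>) (g \<omega>)) \<partial>M)"
    using meas nonempty by (intro integral_eq_nn_integral) (auto intro!: frame_max_nonneg)
  also have "(\<integral>\<^sup>+\<omega>. ennreal (frame_max {..<p} (B \<omega>) (g \<omega>)) \<partial>M)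
      = (\<integral>\<^sup>+y. ?F y \<partial>distr M (borel \<Otimes>\<^sub>M columns_space p) (\<lambda>\<omega>. (g \<omega>, B \<omega>)))"
    using measurable_frame_max_pair by (subst nn_integral_distr[OF pair]) auto
  also have "distr M (borel \<Otimes>\<^sub>M columns_space p) (\<lambda>\<omega>. (g \<omega>, B \<omega>))
      = distr M borel g \<Otimes>\<^sub>M distr M (columns_space p) B"
    by (rule distr_Pair_eq_pair_measure[OF g_measurable B_measurable g_B_indep])
  also have "(\<integral>\<^sup>+y. ?F y \<partial>(distr M borel g \<Otimes>\<^sub>M distr M (columns_space p) B))
      = (\<integral>\<^sup>+v. ennreal (frame_max {..<p} b v) \<partial>distr M borel g)"
    by (rule nn_integral_frame_max_product[OF g_uniform B_uniform b])
  also have "enn2real \<dots> = (\<integral>v. frame_max {..<p} b v \<partial>distr M borel g)"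
    using nonempty by (simp add: integral_frame_max_eq_enn2real)
  finally show ?thesis .
qed

section \<open>Comparing families of different sizes\<close>

text \<open>
  If the product vanished almost surely, then by invariance so would the product of the
  coordinates along \<open>u + v\<close> and \<open>u - v\<close>, that is, the difference of the two squared
  coordinates. Both coordinates would then vanish, and by invariance so would all coordinates
  of \<open>g\<close>, which has norm one.
\<close>

lemma not_AE_product_of_coordinates_eq_0:
  fixes u v :: "real ^ 'd"
  assumes \<mu>: "uniform_on_sphere \<mu>" and uv: "norm u = 1" "norm v = 1" "u \<bullet> v = 0"
  shows "\<not> (AE g in \<mu>. (g \<bullet> u) * (g \<bullet> v) = 0)"
proof
  assume ae: "AE g in \<mu>. (g \<bullet> u) * (g \<bullet> v) = 0"
  interpret \<mu>: prob_space \<mu> using \<mu> by (simp add: uniform_on_sphere_def)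
  have sets[measurable_cong]: "sets \<mu> = sets borel"
    using \<mu> by (simp add: uniform_on_sphere_def)
  have sq: "u \<bullet> u = 1" "v \<bullet> v = 1" "v \<bullet> u = 0"
    using uv by (simp_all add: norm_eq_1 inner_commute)
  define s where "s = (1 / sqrt 2) *\<^sub>R (u + v)"
  define t where "t = (1 / sqrt 2) *\<^sub>R (u - v)"
  have half: "(1 / sqrt 2) * (1 / sqrt 2) = (1 / 2 :: real)" by simp
  have "s \<bullet> s = (1 / sqrt 2) * (1 / sqrt 2) * ((u + v) \<bullet> (u + v))"
    "t \<bullet> t = (1 / sqrt 2) * (1 / sqrt 2) * ((u - v) \<bullet> (u - v))"
    "s \<bullet> t = (1 / sqrt 2) * (1 / sqrt 2) * ((u + v) \<bullet> (u - v))"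
    unfolding s_def t_def by (simp_all only: inner_scaleR_left inner_scaleR_right mult.assoc)
  then have "s \<bullet> s = 1" "t \<bullet> t = 1" "s \<bullet> t = 0"
    unfolding half using uv(3) sq
    by (simp_all add: inner_add_left inner_add_right inner_diff_left inner_diff_right)
  then have ortho: "orthonormal_on UNIV (\<lambda>i. if i then s else t)" "orthonormal_on UNIV (\<lambda>i. if i then u else v)"
    using uv(3) sq by (auto simp: orthonormal_on_def inner_commute)
  obtain f where f: "f \<in> measurable \<mu> \<mu>" "distr \<mu> \<mu> f = \<mu>"
    "\<And>x i. i \<in> UNIV \<Longrightarrow> f x \<bullet> (if i then u else v) = x \<bullet> (if i then s else t)"
    by (rule uniform_on_sphere_transport[OF \<mu> finite_class.finite_UNIV ortho]) blast
  have fu: "f x \<bullet> u = x \<bullet> s" and fv: "f x \<bullet> v = x \<bullet> t" for x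
    using f(3)[of True x] f(3)[of False x] by simp_all
  have "AE g in distr \<mu> \<mu> f. (g \<bullet> u) * (g \<bullet> v) = 0"
    using ae by (simp only: f(2))
  then have "AE g in \<mu>. (f g \<bullet> u) * (f g \<bullet> v) = 0"
    by (subst (asm) AE_distr_iff[OF f(1)]) auto
  with ae have ae_u: "AE g in \<mu>. g \<bullet> u = 0"
  proof eventually_elim
    case (elim g)
    then have "(g \<bullet> s) * (g \<bullet> t) = 0" by (simp add: fu fv)
    then have "(g \<bullet> u + g \<bullet> v) * (g \<bullet> u - g \<bullet> v) = 0"
      by (auto simp: s_def t_def inner_add_right inner_diff_right)
    with elim(1) show ?case by auto
  qed
  \<comment> \<open>A one-element family: every unit vector is the image of \<open>u\<close> under an orthogonal map.\<close>
  have ae_unit: "AE g in \<mu>. g \<bullet> w = 0" if "w \<in> Basis" for w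
  proof -
    have ortho: "orthonormal_on UNIV (\<lambda>_::unit. w)" "orthonormal_on UNIV (\<lambda>_::unit. u)"
      using that sq by (auto simp: orthonormal_on_def)
    obtain f where f: "f \<in> measurable \<mu> \<mu>" "distr \<mu> \<mu> f = \<mu>"
      "\<And>x i. i \<in> (UNIV :: unit set) \<Longrightarrow> f x \<bullet> u = x \<bullet> w"
      by (rule uniform_on_sphere_transport[OF \<mu> finite_class.finite_UNIV ortho]) blast
    have fu: "f x \<bullet> u = x \<bullet> w" for x
      using f(3)[of "()" x] by simp
    have "AE g in distr \<mu> \<mu> f. g \<bullet> u = 0"
      using ae_u by (simp only: f(2))
    then show ?thesis
      by (subst (asm) AE_distr_iff[OF f(1)]) (auto simp: fu)
  qed
  have "AE g in \<mu>. \<forall>w\<in>Basis. g \<bullet> w = 0"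
    using ae_unit by (intro AE_finite_allI) auto
  then have "AE g in \<mu>. g = 0"
    by (rule eventually_mono) (auto intro: euclidean_eqI)
  moreover have "AE g in \<mu>. g \<in> sphere 0 1"
    using \<mu> by (simp add: uniform_on_sphere_def)
  then have "AE g in \<mu>. g \<noteq> 0"
    by (rule eventually_mono) auto
  ultimately show False
    by (rule \<mu>.AE_contr)
qed

lemma frame_max_leave_one_out:
  fixes b :: "nat \<Rightarrow> 'v::euclidean_space"
  assumes "1 \<le> p"
  shows "real p * frame_max {..<p + 1} b g + min \<bar>g \<bullet> b 0\<bar> \<bar>g \<bullet> b 1\<bar>
    \<le> (\<Sum>j<p + 1. frame_max ({..<p + 1} - {j}) b g)"
proof -
  let ?I = "{..<p + 1}"
  have "frame_max ?I b g \<in> (\<lambda>i. \<bar>g \<bullet> b i\<bar>) ` ?I"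
    unfolding frame_max_def by (rule Max_in) (auto simp: lessThan_empty_iff)
  \<comment> \<open>\<open>m\<close> attains the maximum, so leaving out any other index does not lower it.\<close>
  then obtain m where m: "m \<in> ?I" "frame_max ?I b g = \<bar>g \<bullet> b m\<bar>" by auto
  have "real p * frame_max ?I b g = (\<Sum>j\<in>?I - {m}. frame_max ?I b g)"
    using m(1) by simp
  also have "\<dots> \<le> (\<Sum>j\<in>?I - {m}. frame_max (?I - {j}) b g)"
    unfolding m(2) using m(1) by (intro sum_mono frame_max_ge) auto
  finally have "real p * frame_max ?I b g \<le> (\<Sum>j\<in>?I - {m}. frame_max (?I - {j}) b g)" .
  moreover have "min \<bar>g \<bullet> b 0\<bar> \<bar>g \<bullet> b 1\<bar> \<le> frame_max (?I - {m}) b g"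
  proof (cases "m = 0")
    case True
    then show ?thesis
      using frame_max_ge[of "?I - {m}" 1 g b] assms by auto
  next
    case False
    then show ?thesis
      using frame_max_ge[of "?I - {m}" 0 g b] by auto
  qed
  ultimately show ?thesis
    using m(1) by (subst sum.remove[of ?I m]) auto
qed

lemma sphere_average_strict:
  fixes b :: "nat \<Rightarrow> real ^ 'd"
  assumes \<mu>: "uniform_on_sphere \<mu>" and p: "1 \<le> p" and b: "orthonormal_on {..<p + 1} b"
  shows "real p * (\<integral>g. frame_max {..<p + 1} b g \<partial>\<mu>) < real (p + 1) * (\<integral>g. frame_max {..<p} b g \<partial>\<mu>)"
proof -
  interpret \<mu>: prob_space \<mu> using \<mu> by (simp add: uniform_on_sphere_def)
  have sets[measurable_cong]: "sets \<mu> = sets borel"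
    using \<mu> by (simp add: uniform_on_sphere_def)
  have ae: "AE g in \<mu>. norm g = 1"
    using \<mu> by (simp add: uniform_on_sphere_def)
  let ?I = "{..<p + 1}" and ?m = "\<lambda>g. min \<bar>g \<bullet> b 0\<bar> \<bar>g \<bullet> b 1\<bar>"
  have int: "integrable \<mu> (frame_max J b)" if "J \<subseteq> ?I" "J \<noteq> {}" for J
  proof (rule \<mu>.integrable_const_bound[where B = 1])
    have J: "finite J" "orthonormal_on J b"
      using that orthonormal_on_subset[OF b] by (auto intro: finite_subset)
    show "AE g in \<mu>. norm (frame_max J b g) \<le> 1"
      using ae
    proof eventually_elim
      case (elim g)
      then show ?case
        using frame_max_le_norm[OF J(1) that(2) J(2), of g] frame_max_nonneg[OF J(1) that(2), of b g]
        by simp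
    qed
    show "frame_max J b \<in> borel_measurable \<mu>"
      using borel_measurable_frame_max[OF J(1), of b] by (simp cong: measurable_cong_sets add: sets)
  qed
  have int_min: "integrable \<mu> ?m"
  proof (rule Bochner_Integration.integrable_bound[OF int[of ?I]])
    show "AE g in \<mu>. norm (?m g) \<le> norm (frame_max ?I b g)"
    proof (rule AE_I2)
      fix g
      have "\<bar>g \<bullet> b 0\<bar> \<le> frame_max ?I b g"
        by (rule frame_max_ge) auto
      then show "norm (?m g) \<le> norm (frame_max ?I b g)" by simp
    qed
  qed auto
  have pos: "0 < (\<integral>g. ?m g \<partial>\<mu>)"
  proof -
    have "\<not> (AE g in \<mu>. ?m g = 0)"
    proof
      assume "AE g in \<mu>. ?m g = 0"
      then have "AE g in \<mu>. (g \<bullet> b 0) * (g \<bullet> b 1) = 0"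
        by eventually_elim (auto simp: min_def split: if_splits)
      moreover have "b 0 \<bullet> b 0 = 1" "b 1 \<bullet> b 1 = 1" "b 0 \<bullet> b 1 = 0"
        using orthonormal_onD[OF b, of 0 0] orthonormal_onD[OF b, of 1 1] orthonormal_onD[OF b, of 0 1] p
        by simp_all
      ultimately show False
        using not_AE_product_of_coordinates_eq_0[OF \<mu>] by (simp add: norm_eq_1)
    qed
    then have "(\<integral>g. ?m g \<partial>\<mu>) \<noteq> 0"
      using integral_nonneg_eq_0_iff_AE[OF int_min] by auto
    moreover have "0 \<le> (\<integral>g. ?m g \<partial>\<mu>)" by (rule Bochner_Integration.integral_nonneg) simp
    ultimately show ?thesis by linarith
  qed
  have nonempty: "?I - {j} \<noteq> {}" for j
  proof -
    have "0 \<in> ?I - {j} \<or> 1 \<in> ?I - {j}" using p by auto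
    then show ?thesis by (metis empty_iff)
  qed
  have int_I: "integrable \<mu> (\<lambda>g. real p * frame_max ?I b g)"
    using int[of ?I] by (intro integrable_mult_right) (auto simp: lessThan_empty_iff)
  have int_out: "integrable \<mu> (frame_max (?I - {j}) b)" for j
    by (rule int[OF Diff_subset nonempty])
  have "real p * (\<integral>g. frame_max ?I b g \<partial>\<mu>) < real p * (\<integral>g. frame_max ?I b g \<partial>\<mu>) + (\<integral>g. ?m g \<partial>\<mu>)"
    using pos by linarith
  also have "\<dots> = (\<integral>g. real p * frame_max ?I b g + ?m g \<partial>\<mu>)"
    by (simp only: Bochner_Integration.integral_add[OF int_I int_min] integral_mult_right_zero)
  also have "\<dots> \<le> (\<integral>g. (\<Sum>j<p + 1. frame_max (?I - {j}) b g) \<partial>\<mu>)"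
  proof (rule integral_mono)
    show "integrable \<mu> (\<lambda>g. real p * frame_max ?I b g + ?m g)"
      using int_I int_min by (rule Bochner_Integration.integrable_add)
    show "integrable \<mu> (\<lambda>g. \<Sum>j<p + 1. frame_max (?I - {j}) b g)"
      using int_out by (rule Bochner_Integration.integrable_sum)
  qed (rule frame_max_leave_one_out[OF p])
  also have "\<dots> = (\<Sum>j<p + 1. \<integral>g. frame_max (?I - {j}) b g \<partial>\<mu>)"
    using int_out by (rule Bochner_Integration.integral_sum)
  also have "\<dots> = (\<Sum>j<p + 1. \<integral>g. frame_max {..<p} b g \<partial>\<mu>)"
  proof (intro sum.cong refl integral_frame_max_eq[OF \<mu>])
    fix j assume "j \<in> ?I"
    then show "card {..<p} = card (?I - {j})" by simp
  qed (use p orthonormal_on_subset[OF b] in \<open>auto simp: lessThan_empty_iff\<close>)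
  finally show ?thesis by simp
qed

theorem theorem3p8:
  fixes p :: nat
    and M :: "'a measure" and g :: "'a \<Rightarrow> real ^ 'd" and B :: "'a \<Rightarrow> nat \<Rightarrow> real ^ 'd"
    and x :: "real ^ 'd" and x_next :: "'a \<Rightarrow> real ^ 'd"
    and M' :: "'b measure" and g' :: "'b \<Rightarrow> real ^ 'd" and B' :: "'b \<Rightarrow> nat \<Rightarrow> real ^ 'd"
    and x' :: "real ^ 'd" and x_next' :: "'b \<Rightarrow> real ^ 'd"
  assumes "CARD('d) > 1"
    and "1 \<le> p" and "p \<le> CARD('d) - 1"
    and "random_subspace_ds M p g B x x_next"
    and "random_subspace_ds M' (p + 1) g' B' x' x_next'"
  shows "expected_decrease M g x x_next / (2 * real p)
       > expected_decrease M' g' x' x_next' / (2 * real (p + 1))"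
proof -
  interpret R: random_subspace_ds M p g B x x_next by fact
  interpret R': random_subspace_ds M' "p + 1" g' B' x' x_next' by fact
  let ?\<mu> = "distr M borel g" and ?\<mu>' = "distr M' borel g'"
  let ?\<nu>' = "distr M' (columns_space (p + 1)) B'"
  interpret \<nu>': prob_space ?\<nu>'
    using R'.B_uniform by (simp add: uniform_on_stiefel_def)
  \<comment> \<open>A probability measure concentrated on the frames of \<open>p + 1\<close> vectors provides one such frame.\<close>
  have "AE c in ?\<nu>'. c \<in> stiefel (p + 1)"
    using R'.B_uniform unfolding uniform_on_stiefel_def by blast
  then obtain b :: "nat \<Rightarrow> real ^ 'd" where "b \<in> stiefel (p + 1)"
    using \<nu>'.AE_False by (metis (mono_tags, lifting) eventually_mono)
  then have b: "orthonormal_on {..<p + 1} b"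
    by (auto simp: stiefel_def orthonormal_on_def)
  then have b_p: "orthonormal_on {..<p} b"
    by (rule orthonormal_on_subset) auto
  have "norm (b 0) = 1"
    using orthonormal_onD[OF b, of 0 0] by (simp add: norm_eq_1)
  note avg = sphere_average_eq_stiefel_average[OF _ R'.B_uniform b this]
  have "(\<integral>v. frame_max {..<p + 1} b v \<partial>?\<mu>') = (\<integral>v. frame_max {..<p + 1} b v \<partial>?\<mu>)"
    using avg[OF R.g_uniform] avg[OF R'.g_uniform]
    by (simp add: integral_frame_max_eq_enn2real lessThan_empty_iff)
  then have "real p * expected_decrease M' g' x' x_next' < real (p + 1) * expected_decrease M g x x_next"
    using sphere_average_strict[OF R.g_uniform \<open>1 \<le> p\<close> b]
    by (simp only: expected_decrease_eq_sphere_average[OF assms(4,2) b_p]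
        expected_decrease_eq_sphere_average[OF assms(5) _ b] le_add2)
  then show ?thesis
    using \<open>1 \<le> p\<close> by (simp add: field_simps)
qed

end
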